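(* Let $k$ be a commutative ring and let $\mathcal{A}$ be a Krull-Schmidt $k$-category. Suppose $f,g\colon Y\to Z$ are non-zero morphisms in $\mathcal{A}$, and $u\colon Y\to Y$, $v\colon Z\to Z$ are morphisms such that $vf=gu$. (i) If $f,g$ are minimal right almost split, then $u$ is an automorphism of $Y$ if and only if $v$ is an automorphism of $Z$. (ii) If $f,g$ are minimal left almost split, then $u$ is an automorphism of $Y$ if and only if $v$ is an automorphism of $Z$.
   Context: A $k$-category is an additive category whose Hom-sets are $k$-modules and whose composition is $k$-bilinear. An additive category is Krull-Schmidt if every object is a finite direct sum of objects with local endomorphism rings; no Hom-finiteness is assumed. A morphism $f\colon X\to Y$ is right almost split if it is not a retraction and every non-retraction $u\colon U\to Y$ factors as $u=f\hat u$ for some $\hat u\colon U\to X$; it is right minimal if $fg=f$ with $g\colon X\to X$ implies $g$ is an automorphism; it is minimal right almost split if both hold. Minimal left almost split is defined dually. *)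

theory Defs
  imports "HOL-Algebra.Module" "HOL-Algebra.Ideal"
begin

text \<open>Hom-sets are modules in the sense of \<open>HOL-Algebra\<close>; the record fields \<open>mult\<close> and \<open>one\<close> that
  a module inherits from the ring record are never used. The sets \<open>carrier (Hom A X Y)\<close> need not be
  disjoint for different pairs of objects, so composition is indexed by the objects involved:
  for \<open>f : X \<rightarrow> Y\<close> and \<open>g : Y \<rightarrow> Z\<close> the composite \<open>gf : X \<rightarrow> Z\<close> is \<open>Comp A X Y Z g f\<close>.\<close>

record ('o, 'm, 'k) kcat =
  Obj :: "'o set"
  Hom :: "'o \<Rightarrow> 'o \<Rightarrow> ('k, 'm) module"
  Idm :: "'o \<Rightarrow> 'm"
  Comp :: "'o \<Rightarrow> 'o \<Rightarrow> 'o \<Rightarrow> 'm \<Rightarrow> 'm \<Rightarrow> 'm"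

abbreviation Mor :: "('o, 'm, 'k) kcat \<Rightarrow> 'o \<Rightarrow> 'o \<Rightarrow> 'm set" where
  "Mor A X Y \<equiv> carrier (Hom A X Y)"

locale k_linear_category =
  fixes K :: "('k, 'r) ring_scheme" and A :: "('o, 'm, 'k) kcat"
  assumes cring: "cring K"
    and hom_module: "\<lbrakk>X \<in> Obj A; Y \<in> Obj A\<rbrakk> \<Longrightarrow> module K (Hom A X Y)"
    and id_closed: "X \<in> Obj A \<Longrightarrow> Idm A X \<in> Mor A X X"
    and comp_closed: "\<lbrakk>X \<in> Obj A; Y \<in> Obj A; Z \<in> Obj A; g \<in> Mor A Y Z; f \<in> Mor A X Y\<rbrakk>
      \<Longrightarrow> Comp A X Y Z g f \<in> Mor A X Z"
    and id_left: "\<lbrakk>X \<in> Obj A; Y \<in> Obj A; f \<in> Mor A X Y\<rbrakk> \<Longrightarrow> Comp A X Y Y (Idm A Y) f = f"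
    and id_right: "\<lbrakk>X \<in> Obj A; Y \<in> Obj A; f \<in> Mor A X Y\<rbrakk> \<Longrightarrow> Comp A X X Y f (Idm A X) = f"
    and comp_assoc: "\<lbrakk>W \<in> Obj A; X \<in> Obj A; Y \<in> Obj A; Z \<in> Obj A;
        h \<in> Mor A Y Z; g \<in> Mor A X Y; f \<in> Mor A W X\<rbrakk>
      \<Longrightarrow> Comp A W X Z (Comp A X Y Z h g) f = Comp A W Y Z h (Comp A W X Y g f)"
    and comp_add_left: "\<lbrakk>X \<in> Obj A; Y \<in> Obj A; Z \<in> Obj A;
        g \<in> Mor A Y Z; g' \<in> Mor A Y Z; f \<in> Mor A X Y\<rbrakk>
      \<Longrightarrow> Comp A X Y Z (g \<oplus>\<^bsub>Hom A Y Z\<^esub> g') f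
        = Comp A X Y Z g f \<oplus>\<^bsub>Hom A X Z\<^esub> Comp A X Y Z g' f"
    and comp_add_right: "\<lbrakk>X \<in> Obj A; Y \<in> Obj A; Z \<in> Obj A;
        g \<in> Mor A Y Z; f \<in> Mor A X Y; f' \<in> Mor A X Y\<rbrakk>
      \<Longrightarrow> Comp A X Y Z g (f \<oplus>\<^bsub>Hom A X Y\<^esub> f')
        = Comp A X Y Z g f \<oplus>\<^bsub>Hom A X Z\<^esub> Comp A X Y Z g f'"
    and comp_smult_left: "\<lbrakk>X \<in> Obj A; Y \<in> Obj A; Z \<in> Obj A;
        a \<in> carrier K; g \<in> Mor A Y Z; f \<in> Mor A X Y\<rbrakk>
      \<Longrightarrow> Comp A X Y Z (a \<odot>\<^bsub>Hom A Y Z\<^esub> g) f = a \<odot>\<^bsub>Hom A X Z\<^esub> Comp A X Y Z g f"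
    and comp_smult_right: "\<lbrakk>X \<in> Obj A; Y \<in> Obj A; Z \<in> Obj A;
        a \<in> carrier K; g \<in> Mor A Y Z; f \<in> Mor A X Y\<rbrakk>
      \<Longrightarrow> Comp A X Y Z g (a \<odot>\<^bsub>Hom A X Y\<^esub> f) = a \<odot>\<^bsub>Hom A X Z\<^esub> Comp A X Y Z g f"

text \<open>\<open>X\<close> is a direct sum (biproduct) of the finite list \<open>S\<close> of objects. For the empty list this
  says \<open>Idm A X = 0\<close>, that is, \<open>X\<close> is a zero object.\<close>

definition is_direct_sum :: "('o, 'm, 'k) kcat \<Rightarrow> 'o \<Rightarrow> 'o list \<Rightarrow> bool" where
  "is_direct_sum A X S \<longleftrightarrow> (\<exists>\<iota> \<pi>.
     (\<forall>i<length S. \<iota> i \<in> Mor A (S ! i) X \<and> \<pi> i \<in> Mor A X (S ! i)) \<and>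
     (\<forall>i<length S. \<forall>j<length S.
        Comp A (S ! j) X (S ! i) (\<pi> i) (\<iota> j)
          = (if i = j then Idm A (S ! i) else \<zero>\<^bsub>Hom A (S ! j) (S ! i)\<^esub>)) \<and>
     (\<Oplus>\<^bsub>Hom A X X\<^esub>i\<in>{..<length S}. Comp A X (S ! i) X (\<iota> i) (\<pi> i)) = Idm A X)"

text \<open>Additivity is the existence of all finite direct sums, including the empty one.\<close>

locale k_category = k_linear_category +
  assumes direct_sums: "set S \<subseteq> Obj A \<Longrightarrow> \<exists>X\<in>Obj A. is_direct_sum A X S"

definition End_ring :: "('o, 'm, 'k) kcat \<Rightarrow> 'o \<Rightarrow> 'm ring" where
  "End_ring A X = \<lparr>carrier = Mor A X X, mult = Comp A X X X, one = Idm A X,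
     zero = \<zero>\<^bsub>Hom A X X\<^esub>, add = add (Hom A X X)\<rparr>"

text \<open>A not necessarily commutative ring is local if its non-units form a two-sided ideal. This
  excludes the zero ring, in which the set of non-units is empty.\<close>

definition local_ring :: "('a, 'b) ring_scheme \<Rightarrow> bool" where
  "local_ring R \<longleftrightarrow> ring R \<and> ideal (carrier R - Units R) R"

locale krull_schmidt_k_category = k_category +
  assumes decomposition: "X \<in> Obj A \<Longrightarrow>
    \<exists>S. set S \<subseteq> Obj A \<and> (\<forall>Y\<in>set S. local_ring (End_ring A Y)) \<and> is_direct_sum A X S"

definition retraction :: "('o, 'm, 'k) kcat \<Rightarrow> 'o \<Rightarrow> 'o \<Rightarrow> 'm \<Rightarrow> bool" where
  "retraction A X Y f \<longleftrightarrow> f \<in> Mor A X Y \<and> (\<exists>s\<in>Mor A Y X. Comp A Y X Y f s = Idm A Y)"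

definition section_mor :: "('o, 'm, 'k) kcat \<Rightarrow> 'o \<Rightarrow> 'o \<Rightarrow> 'm \<Rightarrow> bool" where
  "section_mor A X Y f \<longleftrightarrow> f \<in> Mor A X Y \<and> (\<exists>r\<in>Mor A Y X. Comp A X Y X r f = Idm A X)"

definition automorphism :: "('o, 'm, 'k) kcat \<Rightarrow> 'o \<Rightarrow> 'm \<Rightarrow> bool" where
  "automorphism A X u \<longleftrightarrow> u \<in> Mor A X X \<and>
     (\<exists>w\<in>Mor A X X. Comp A X X X w u = Idm A X \<and> Comp A X X X u w = Idm A X)"

definition right_almost_split :: "('o, 'm, 'k) kcat \<Rightarrow> 'o \<Rightarrow> 'o \<Rightarrow> 'm \<Rightarrow> bool" where
  "right_almost_split A X Y f \<longleftrightarrow> f \<in> Mor A X Y \<and> \<not> retraction A X Y f \<and>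
     (\<forall>U\<in>Obj A. \<forall>u\<in>Mor A U Y. \<not> retraction A U Y u \<longrightarrow>
        (\<exists>w\<in>Mor A U X. u = Comp A U X Y f w))"

definition right_minimal :: "('o, 'm, 'k) kcat \<Rightarrow> 'o \<Rightarrow> 'o \<Rightarrow> 'm \<Rightarrow> bool" where
  "right_minimal A X Y f \<longleftrightarrow> f \<in> Mor A X Y \<and>
     (\<forall>g\<in>Mor A X X. Comp A X X Y f g = f \<longrightarrow> automorphism A X g)"

definition minimal_right_almost_split :: "('o, 'm, 'k) kcat \<Rightarrow> 'o \<Rightarrow> 'o \<Rightarrow> 'm \<Rightarrow> bool" where
  "minimal_right_almost_split A X Y f \<longleftrightarrow> right_minimal A X Y f \<and> right_almost_split A X Y f"

definition left_almost_split :: "('o, 'm, 'k) kcat \<Rightarrow> 'o \<Rightarrow> 'o \<Rightarrow> 'm \<Rightarrow> bool" where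
  "left_almost_split A X Y f \<longleftrightarrow> f \<in> Mor A X Y \<and> \<not> section_mor A X Y f \<and>
     (\<forall>U\<in>Obj A. \<forall>u\<in>Mor A X U. \<not> section_mor A X U u \<longrightarrow>
        (\<exists>w\<in>Mor A Y U. u = Comp A X Y U w f))"

definition left_minimal :: "('o, 'm, 'k) kcat \<Rightarrow> 'o \<Rightarrow> 'o \<Rightarrow> 'm \<Rightarrow> bool" where
  "left_minimal A X Y f \<longleftrightarrow> f \<in> Mor A X Y \<and>
     (\<forall>g\<in>Mor A Y Y. Comp A X Y Y g f = f \<longrightarrow> automorphism A Y g)"

definition minimal_left_almost_split :: "('o, 'm, 'k) kcat \<Rightarrow> 'o \<Rightarrow> 'o \<Rightarrow> 'm \<Rightarrow> bool" where
  "minimal_left_almost_split A X Y f \<longleftrightarrow> left_minimal A X Y f \<and> left_almost_split A X Y f"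

end

theory Submission
  imports Defs
begin

text \<open>
  Part (ii) is part (i) in the opposite category, where \<open>f\<close> and \<open>g\<close>, and also \<open>u\<close> and \<open>v\<close>,
  exchange their roles. So let \<open>f\<close> and \<open>g\<close> be minimal right almost split with target \<open>Z\<close>.

  Every non-retraction into \<open>Z\<close> factors through \<open>f\<close>, hence the sum of two non-retractions into \<open>Z\<close>
  factors through \<open>f\<close> too and is never the identity. This makes the endomorphism ring of \<open>Z\<close> local;
  concretely, one of two endomorphisms with sum \<open>1\<close> is a retraction
  (\<open>retraction_or_complement\<close>), and a retraction \<open>Z \<rightarrow> Z\<close> is an automorphism
  (\<open>retraction_imp_automorphism\<close>).

  If \<open>v\<close> is an automorphism, then \<open>v\<^sup>-\<^sup>1g\<close> is not a retraction, so \<open>v\<^sup>-\<^sup>1g = fw\<close>. It follows that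
  \<open>fwu = f\<close> and \<open>guw = g\<close>, and by minimality \<open>wu\<close> and \<open>uw\<close> are automorphisms, whence \<open>u\<close> is one.

  If \<open>u\<close> is an automorphism but \<open>v\<close> is not, then \<open>v\<close> is not a retraction, so \<open>v = gw\<close> with
  \<open>w : Z \<rightarrow> Y\<close>. Now \<open>g = vfu\<^sup>-\<^sup>1 = gwfu\<^sup>-\<^sup>1\<close>, so \<open>wfu\<^sup>-\<^sup>1\<close> is an automorphism by minimality, and
  \<open>f\<close> is a section. But a non-zero right almost split morphism is never a section
  (\<open>right_almost_split_section_imp_zero\<close>): if \<open>rf = 1\<close>, then \<open>1 - fr\<close> is an automorphism of \<open>Z\<close>
  that annihilates \<open>f\<close>.
\<close>

section \<open>The opposite category\<close>

definition opposite :: "('o, 'm, 'k) kcat \<Rightarrow> ('o, 'm, 'k) kcat" where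
  "opposite A = \<lparr>Obj = Obj A, Hom = (\<lambda>X Y. Hom A Y X), Idm = Idm A,
     Comp = (\<lambda>X Y Z g f. Comp A Z Y X f g)\<rparr>"

lemma opposite_sel [simp]:
  "Obj (opposite A) = Obj A" "Hom (opposite A) X Y = Hom A Y X" "Idm (opposite A) = Idm A"
  "Comp (opposite A) X Y Z g f = Comp A Z Y X f g"
  by (simp_all add: opposite_def)

lemma automorphism_opposite: "automorphism (opposite A) X u = automorphism A X u"
  by (auto simp: automorphism_def)

lemma minimal_right_almost_split_opposite:
  "minimal_right_almost_split (opposite A) Z Y f = minimal_left_almost_split A Y Z f"
  by (simp add: minimal_right_almost_split_def minimal_left_almost_split_def right_minimal_def
      left_minimal_def right_almost_split_def left_almost_split_def retraction_def
      section_mor_def automorphism_opposite)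

section \<open>Composition, retractions and sections\<close>

lemma automorphism_iff_retraction_section:
  assumes "k_linear_category K A" "X \<in> Obj A"
  shows "automorphism A X u \<longleftrightarrow> retraction A X X u \<and> section_mor A X X u"
proof -
  interpret k_linear_category K A by (fact assms(1))
  have "r = s" if "u \<in> Mor A X X" "s \<in> Mor A X X" "r \<in> Mor A X X"
      "Comp A X X X u s = Idm A X" "Comp A X X X r u = Idm A X" for r s
    using comp_assoc[of X X X X r u s] that assms(2) id_left id_right by metis
  then show ?thesis
    unfolding automorphism_def retraction_def section_mor_def by metis
qed

context k_linear_category
begin

lemma k_linear_category_opposite: "k_linear_category K (opposite A)"
  by (rule k_linear_category.intro)
    (simp_all add: cring hom_module id_closed comp_closed id_left id_right comp_assoc
      comp_add_left comp_add_right comp_smult_left comp_smult_right)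

lemma hom_abelian_group: "\<lbrakk>X \<in> Obj A; Y \<in> Obj A\<rbrakk> \<Longrightarrow> abelian_group (Hom A X Y)"
  using hom_module by (simp add: module_def)

lemma hom_add_eq_left_imp_zero:
  assumes "X \<in> Obj A" "Y \<in> Obj A" "a \<in> Mor A X Y" "b \<in> Mor A X Y" "a = a \<oplus>\<^bsub>Hom A X Y\<^esub> b"
  shows "b = \<zero>\<^bsub>Hom A X Y\<^esub>"
proof -
  interpret H: abelian_group "Hom A X Y" using assms by (simp add: hom_abelian_group)
  show ?thesis using assms H.add.l_cancel_one by metis
qed

text \<open>With \<open>b = 1\<close> this provides the complement \<open>1 - a\<close> of an endomorphism \<open>a\<close>.\<close>

lemma hom_complement_exists:
  assumes "X \<in> Obj A" "Y \<in> Obj A" "a \<in> Mor A X Y" "b \<in> Mor A X Y"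
  obtains c where "c \<in> Mor A X Y" "a \<oplus>\<^bsub>Hom A X Y\<^esub> c = b"
proof -
  interpret H: abelian_group "Hom A X Y" using assms by (simp add: hom_abelian_group)
  show ?thesis
    using that[of "\<ominus>\<^bsub>Hom A X Y\<^esub> a \<oplus>\<^bsub>Hom A X Y\<^esub> b"] assms H.r_neg2 H.a_closed H.a_inv_closed
    by simp
qed

lemma comp_zero_left:
  assumes "X \<in> Obj A" "Y \<in> Obj A" "Z \<in> Obj A" "f \<in> Mor A X Y"
  shows "Comp A X Y Z \<zero>\<^bsub>Hom A Y Z\<^esub> f = \<zero>\<^bsub>Hom A X Z\<^esub>"
proof -
  interpret H: abelian_group "Hom A Y Z" using assms by (simp add: hom_abelian_group)
  have "Comp A X Y Z \<zero>\<^bsub>Hom A Y Z\<^esub> f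
      = Comp A X Y Z \<zero>\<^bsub>Hom A Y Z\<^esub> f \<oplus>\<^bsub>Hom A X Z\<^esub> Comp A X Y Z \<zero>\<^bsub>Hom A Y Z\<^esub> f"
    using comp_add_left[of X Y Z "\<zero>\<^bsub>Hom A Y Z\<^esub>" "\<zero>\<^bsub>Hom A Y Z\<^esub>" f] assms by simp
  then show ?thesis
    using hom_add_eq_left_imp_zero comp_closed assms H.zero_closed by metis
qed

lemma comp_zero_right:
  assumes "X \<in> Obj A" "Y \<in> Obj A" "Z \<in> Obj A" "g \<in> Mor A Y Z"
  shows "Comp A X Y Z g \<zero>\<^bsub>Hom A X Y\<^esub> = \<zero>\<^bsub>Hom A X Z\<^esub>"
  using k_linear_category.comp_zero_left[OF k_linear_category_opposite, of Z Y X g] assms by simp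

lemma retraction_comp_imp:
  assumes "X \<in> Obj A" "Y \<in> Obj A" "Z \<in> Obj A" "g \<in> Mor A Y Z" "f \<in> Mor A X Y"
    and "retraction A X Z (Comp A X Y Z g f)"
  shows "retraction A Y Z g"
  using assms comp_assoc[of Z X Y Z g f] comp_closed unfolding retraction_def by metis

lemma section_comp_imp:
  assumes "X \<in> Obj A" "Y \<in> Obj A" "Z \<in> Obj A" "g \<in> Mor A Y Z" "f \<in> Mor A X Y"
    and "section_mor A X Z (Comp A X Y Z g f)"
  shows "section_mor A X Y f"
  using k_linear_category.retraction_comp_imp[OF k_linear_category_opposite, of Z Y X f g] assms
  by (simp add: retraction_def section_mor_def)

lemma automorphism_if_comps_automorphisms:
  assumes "X \<in> Obj A" "u \<in> Mor A X X" "w \<in> Mor A X X"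
    and "automorphism A X (Comp A X X X w u)" "automorphism A X (Comp A X X X u w)"
  shows "automorphism A X u"
proof -
  note iff = automorphism_iff_retraction_section[OF k_linear_category_axioms assms(1)]
  show ?thesis
    using assms retraction_comp_imp section_comp_imp unfolding iff by metis
qed

section \<open>Endomorphisms of the target of a right almost split morphism\<close>

text \<open>Two non-retractions \<open>a\<close> and \<open>b\<close> factor as \<open>a = fs\<close> and \<open>b = ft\<close>. Then \<open>a + b = f(s + t)\<close>,
  which is not the identity, as \<open>f\<close> is not a retraction.\<close>

lemma retraction_or_complement:
  assumes "Y \<in> Obj A" "Z \<in> Obj A" "right_almost_split A Y Z f"
    and ab: "a \<in> Mor A Z Z" "b \<in> Mor A Z Z" "a \<oplus>\<^bsub>Hom A Z Z\<^esub> b = Idm A Z"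
  shows "retraction A Z Z a \<or> retraction A Z Z b"
proof (rule ccontr)
  assume "\<not> ?thesis"
  then obtain s t where st: "s \<in> Mor A Z Y" "t \<in> Mor A Z Y"
      "a = Comp A Z Y Z f s" "b = Comp A Z Y Z f t"
    using assms unfolding right_almost_split_def by metis
  interpret H: abelian_group "Hom A Z Y" using assms by (simp add: hom_abelian_group)
  have "f \<in> Mor A Y Z" "\<not> retraction A Y Z f"
    using assms(3) by (auto simp: right_almost_split_def)
  moreover have "Comp A Z Y Z f (s \<oplus>\<^bsub>Hom A Z Y\<^esub> t) = Idm A Z"
    using calculation st ab assms(1,2) by (simp add: comp_add_right)
  ultimately show False
    using st H.a_closed unfolding retraction_def by blast
qed

text \<open>Every morphism into a zero object is a retraction, with the zero morphism as a splitting.\<close>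

lemma right_almost_split_target_nonzero:
  assumes "Y \<in> Obj A" "Z \<in> Obj A" "right_almost_split A Y Z f"
  shows "Idm A Z \<noteq> \<zero>\<^bsub>Hom A Z Z\<^esub>"
proof
  assume 0: "Idm A Z = \<zero>\<^bsub>Hom A Z Z\<^esub>"
  interpret H: abelian_group "Hom A Z Y" using assms by (simp add: hom_abelian_group)
  show False
    using assms 0 comp_zero_right[of Z Y Z f] H.zero_closed
    unfolding right_almost_split_def retraction_def by metis
qed

text \<open>Let \<open>ab = 1\<close>. By \<open>retraction_or_complement\<close>, one of \<open>ba\<close> and \<open>p = 1 - ba\<close> is a retraction.
  It is not \<open>p\<close>, because \<open>ap = 0\<close> and a retraction can be cancelled on the right, which would
  give \<open>a = 0\<close>. So \<open>ba\<close>, and with it \<open>b\<close>, is a retraction. As \<open>b\<close> is also a section, it is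
  invertible, and \<open>a\<close> is its inverse.\<close>

lemma retraction_imp_automorphism:
  assumes obj: "Y \<in> Obj A" "Z \<in> Obj A" and f: "right_almost_split A Y Z f"
    and "retraction A Z Z a"
  shows "automorphism A Z a"
proof -
  obtain b where a: "a \<in> Mor A Z Z" and b: "b \<in> Mor A Z Z" and ab: "Comp A Z Z Z a b = Idm A Z"
    using assms(4) unfolding retraction_def by blast
  let ?e = "Comp A Z Z Z b a"
  have e: "?e \<in> Mor A Z Z" using obj a b comp_closed by blast
  obtain p where p: "p \<in> Mor A Z Z" "?e \<oplus>\<^bsub>Hom A Z Z\<^esub> p = Idm A Z"
    using hom_complement_exists obj e id_closed by metis
  have "Comp A Z Z Z a ?e = a"
    using comp_assoc[of Z Z Z Z a b a] obj a b ab id_left by metis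
  then have "a = a \<oplus>\<^bsub>Hom A Z Z\<^esub> Comp A Z Z Z a p"
    using comp_add_right[of Z Z Z a ?e p] obj a e p id_right by metis
  then have ap: "Comp A Z Z Z a p = \<zero>\<^bsub>Hom A Z Z\<^esub>"
    using hom_add_eq_left_imp_zero obj a p(1) comp_closed by metis
  have "\<not> retraction A Z Z p"
  proof
    assume "retraction A Z Z p"
    then obtain c where c: "c \<in> Mor A Z Z" "Comp A Z Z Z p c = Idm A Z"
      unfolding retraction_def by blast
    have "a = \<zero>\<^bsub>Hom A Z Z\<^esub>"
      using comp_assoc[of Z Z Z Z a p c] obj a p c ap id_right comp_zero_left by metis
    then show False
      using ab comp_zero_left[of Z Z Z b] obj b right_almost_split_target_nonzero[OF obj f] by metis
  qed
  then have "retraction A Z Z ?e"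
    using retraction_or_complement[OF obj f e p] by blast
  then have "retraction A Z Z b" using retraction_comp_imp obj a b by blast
  moreover have "section_mor A Z Z b"
    using a b ab unfolding section_mor_def by blast
  ultimately have "automorphism A Z b"
    using automorphism_iff_retraction_section[OF k_linear_category_axioms] obj by blast
  then obtain c where c: "c \<in> Mor A Z Z" "Comp A Z Z Z b c = Idm A Z" "Comp A Z Z Z c b = Idm A Z"
    unfolding automorphism_def by blast
  have "c = a"
    using comp_assoc[of Z Z Z Z a b c] obj a b c ab id_left id_right by metis
  then show ?thesis using a b ab c unfolding automorphism_def by blast
qed

text \<open>Let \<open>rf = 1\<close>. Since \<open>f\<close> is not a retraction, neither is \<open>fr\<close>, so \<open>p = 1 - fr\<close> is an
  automorphism. But \<open>pf = f - frf = 0\<close>.\<close>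

lemma right_almost_split_section_imp_zero:
  assumes obj: "Y \<in> Obj A" "Z \<in> Obj A" and f: "right_almost_split A Y Z f"
    and "section_mor A Y Z f"
  shows "f = \<zero>\<^bsub>Hom A Y Z\<^esub>"
proof -
  obtain r where fM: "f \<in> Mor A Y Z" and r: "r \<in> Mor A Z Y" and rf: "Comp A Y Z Y r f = Idm A Y"
    using assms(4) unfolding section_mor_def by blast
  let ?e = "Comp A Z Y Z f r"
  have e: "?e \<in> Mor A Z Z" using obj fM r comp_closed by blast
  obtain p where p: "p \<in> Mor A Z Z" "?e \<oplus>\<^bsub>Hom A Z Z\<^esub> p = Idm A Z"
    using hom_complement_exists obj e id_closed by metis
  have "Comp A Y Z Z ?e f = f"
    using comp_assoc[of Y Z Y Z f r f] obj fM r rf id_right by metis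
  then have "f = f \<oplus>\<^bsub>Hom A Y Z\<^esub> Comp A Y Z Z p f"
    using comp_add_left[of Y Z Z ?e p f] obj fM e p id_left by metis
  then have pf: "Comp A Y Z Z p f = \<zero>\<^bsub>Hom A Y Z\<^esub>"
    using hom_add_eq_left_imp_zero obj fM p(1) comp_closed by metis
  have "\<not> retraction A Z Z ?e"
    using f retraction_comp_imp[of Z Y Z f r] obj fM r unfolding right_almost_split_def by blast
  then have "automorphism A Z p"
    using retraction_or_complement[OF obj f e p] retraction_imp_automorphism[OF obj f] by blast
  then obtain q where q: "q \<in> Mor A Z Z" "Comp A Z Z Z q p = Idm A Z"
    unfolding automorphism_def by blast
  then show ?thesis
    using comp_assoc[of Y Z Z Z q p f] obj fM p pf id_left comp_zero_right by metis
qed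

section \<open>Commutative squares of minimal right almost split morphisms\<close>

text \<open>Up to the automorphism \<open>v\<close>, the morphisms \<open>f\<close> and \<open>g\<close> factor through each other: \<open>v\<^sup>-\<^sup>1g = fw\<close> for some
  \<open>w\<close>, and \<open>vf = gu\<close>. Substituting one into the other in both orders gives \<open>fwu = f\<close> and
  \<open>guw = g\<close>, to which right minimality applies.\<close>

lemma automorphism_source_if_target:
  assumes obj: "Y \<in> Obj A" "Z \<in> Obj A"
    and f: "minimal_right_almost_split A Y Z f" and g: "minimal_right_almost_split A Y Z g"
    and u: "u \<in> Mor A Y Y" and eq: "Comp A Y Z Z v f = Comp A Y Y Z g u"
    and "automorphism A Z v"
  shows "automorphism A Y u"
proof -
  have fM: "f \<in> Mor A Y Z" and gM: "g \<in> Mor A Y Z"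
    using f g by (auto simp: minimal_right_almost_split_def right_minimal_def)
  obtain v' where v: "v \<in> Mor A Z Z" and v': "v' \<in> Mor A Z Z"
      "Comp A Z Z Z v' v = Idm A Z" "Comp A Z Z Z v v' = Idm A Z"
    using assms(7) unfolding automorphism_def by blast
  let ?h = "Comp A Y Z Z v' g"
  have h: "?h \<in> Mor A Y Z" using obj gM v' comp_closed by blast
  have vh: "Comp A Y Z Z v ?h = g"
    using comp_assoc[of Y Z Z Z v v' g] obj v v' gM id_left by metis
  \<comment> \<open>If \<open>v\<^sup>-\<^sup>1gs = 1\<close>, then \<open>gs = v\<close> is invertible and \<open>g\<close> would be a retraction.\<close>
  have "\<not> retraction A Y Z ?h"
  proof
    assume "retraction A Y Z ?h"
    then obtain s where s: "s \<in> Mor A Z Y" "Comp A Z Y Z ?h s = Idm A Z"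
      unfolding retraction_def by blast
    have "Comp A Z Y Z g s = v"
      using comp_assoc[of Z Y Z Z v ?h s] obj v h s vh id_right by metis
    then have "retraction A Z Z (Comp A Z Y Z g s)"
      using v v' unfolding retraction_def by blast
    then show False
      using retraction_comp_imp[of Z Y Z g s] obj gM s g
      unfolding minimal_right_almost_split_def right_almost_split_def by blast
  qed
  then obtain w where w: "w \<in> Mor A Y Y" "?h = Comp A Y Y Z f w"
    using f h obj unfolding minimal_right_almost_split_def right_almost_split_def by blast
  have wu: "Comp A Y Y Y w u \<in> Mor A Y Y" and uw: "Comp A Y Y Y u w \<in> Mor A Y Y"
    using obj u w comp_closed by blast+
  have "Comp A Y Y Z f (Comp A Y Y Y w u) = Comp A Y Y Z ?h u"
    using comp_assoc[of Y Y Y Z f w u] obj fM w u by metis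
  also have "\<dots> = Comp A Y Z Z v' (Comp A Y Z Z v f)"
    using comp_assoc[of Y Y Z Z v' g u] obj v' gM u eq by metis
  also have "\<dots> = f"
    using comp_assoc[of Y Z Z Z v' v f] obj v v' fM id_left by metis
  finally have 1: "automorphism A Y (Comp A Y Y Y w u)"
    using f wu unfolding minimal_right_almost_split_def right_minimal_def by blast
  have "Comp A Y Y Z g (Comp A Y Y Y u w) = Comp A Y Y Z (Comp A Y Z Z v f) w"
    using comp_assoc[of Y Y Y Z g u w] obj gM w u eq by metis
  also have "\<dots> = Comp A Y Z Z v ?h"
    using comp_assoc[of Y Y Z Z v f w] obj v fM w by metis
  also note vh
  finally have "automorphism A Y (Comp A Y Y Y u w)"
    using g uw unfolding minimal_right_almost_split_def right_minimal_def by blast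
  with 1 show ?thesis
    using automorphism_if_comps_automorphisms obj u w by blast
qed

text \<open>If \<open>v\<close> were not an automorphism, it would factor as \<open>v = gw\<close>. Then \<open>gwf = vf = gu\<close>, and
  right minimality of \<open>g\<close> makes \<open>wf\<close> invertible up to \<open>u\<close>. So \<open>f\<close> is a section, which the
  preceding results exclude for \<open>f \<noteq> 0\<close>.\<close>

lemma automorphism_target_if_source:
  assumes obj: "Y \<in> Obj A" "Z \<in> Obj A"
    and f: "right_almost_split A Y Z f" "f \<noteq> \<zero>\<^bsub>Hom A Y Z\<^esub>"
    and g: "minimal_right_almost_split A Y Z g"
    and v: "v \<in> Mor A Z Z" and eq: "Comp A Y Z Z v f = Comp A Y Y Z g u"
    and "automorphism A Y u"
  shows "automorphism A Z v"
proof (rule ccontr)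
  assume "\<not> automorphism A Z v"
  then have "\<not> retraction A Z Z v" using retraction_imp_automorphism[OF obj f(1)] by blast
  then obtain w where w: "w \<in> Mor A Z Y" "v = Comp A Z Y Z g w"
    using g v obj unfolding minimal_right_almost_split_def right_almost_split_def by blast
  have fM: "f \<in> Mor A Y Z" and gM: "g \<in> Mor A Y Z"
    using f g by (auto simp: minimal_right_almost_split_def right_almost_split_def)
  obtain u' where u: "u \<in> Mor A Y Y" and u': "u' \<in> Mor A Y Y"
      "Comp A Y Y Y u' u = Idm A Y" "Comp A Y Y Y u u' = Idm A Y"
    using assms(8) unfolding automorphism_def by blast
  let ?wf = "Comp A Y Z Y w f"
  let ?a = "Comp A Y Y Y ?wf u'"
  have wf: "?wf \<in> Mor A Y Y" using obj w fM comp_closed by blast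
  have a: "?a \<in> Mor A Y Y" using obj wf u' comp_closed by blast
  have "Comp A Y Y Z g ?wf = Comp A Y Y Z g u"
    using comp_assoc[of Y Z Y Z g w f] obj gM w fM eq by metis
  then have "Comp A Y Y Z g ?a = Comp A Y Y Z (Comp A Y Y Z g u) u'"
    using comp_assoc[of Y Y Y Z g ?wf u'] obj gM wf u' by metis
  also have "\<dots> = g"
    using comp_assoc[of Y Y Y Z g u u'] obj gM u u' id_right by metis
  finally have "automorphism A Y ?a"
    using g a unfolding minimal_right_almost_split_def right_minimal_def by blast
  then obtain b where b: "b \<in> Mor A Y Y" "Comp A Y Y Y b ?a = Idm A Y"
    unfolding automorphism_def by blast
  have ba: "Comp A Y Y Y b ?wf = u"
  proof -
    have bwf: "Comp A Y Y Y b ?wf \<in> Mor A Y Y" using obj b wf comp_closed by blast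
    have "Comp A Y Y Y (Comp A Y Y Y b ?wf) u' = Idm A Y"
      using comp_assoc[of Y Y Y Y b ?wf u'] obj b wf u' by metis
    then show ?thesis
      using comp_assoc[of Y Y Y Y "Comp A Y Y Y b ?wf" u' u] obj bwf u u' id_left id_right by metis
  qed
  have bw: "Comp A Z Y Y b w \<in> Mor A Z Y" using obj b w comp_closed by blast
  have "Comp A Y Z Y (Comp A Z Y Y b w) f = u"
    using comp_assoc[of Y Z Y Y b w f] obj b w fM ba by metis
  then have "section_mor A Y Y (Comp A Y Z Y (Comp A Z Y Y b w) f)"
    using u u' unfolding section_mor_def by blast
  then have "section_mor A Y Z f" using section_comp_imp obj bw fM by blast
  then show False using right_almost_split_section_imp_zero[OF obj f(1)] f(2) by blast
qed

lemma automorphism_iff_if_minimal_right_almost_split: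
  assumes "Y \<in> Obj A" "Z \<in> Obj A"
    and "minimal_right_almost_split A Y Z f" "f \<noteq> \<zero>\<^bsub>Hom A Y Z\<^esub>"
    and "minimal_right_almost_split A Y Z g"
    and "u \<in> Mor A Y Y" "v \<in> Mor A Z Z" and "Comp A Y Z Z v f = Comp A Y Y Z g u"
  shows "automorphism A Y u \<longleftrightarrow> automorphism A Z v"
  using assms automorphism_source_if_target[of Y Z f g u v]
    automorphism_target_if_source[of Y Z f g v u] minimal_right_almost_split_def by metis

end

theorem lemma4p8:
  fixes K :: "('k, 'r) ring_scheme" and A :: "('o, 'm, 'k) kcat"
    and Y Z :: 'o and f g u v :: 'm
  assumes "krull_schmidt_k_category K A"
    and "Y \<in> Obj A" and "Z \<in> Obj A"
    and "f \<in> Mor A Y Z" and "f \<noteq> \<zero>\<^bsub>Hom A Y Z\<^esub>"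
    and "g \<in> Mor A Y Z" and "g \<noteq> \<zero>\<^bsub>Hom A Y Z\<^esub>"
    and "u \<in> Mor A Y Y" and "v \<in> Mor A Z Z"
    and "Comp A Y Z Z v f = Comp A Y Y Z g u"
  shows "(minimal_right_almost_split A Y Z f \<and> minimal_right_almost_split A Y Z g
            \<longrightarrow> (automorphism A Y u \<longleftrightarrow> automorphism A Z v))
       \<and> (minimal_left_almost_split A Y Z f \<and> minimal_left_almost_split A Y Z g
            \<longrightarrow> (automorphism A Y u \<longleftrightarrow> automorphism A Z v))"
proof -
  interpret krull_schmidt_k_category K A by (fact assms(1))
  interpret Op: k_linear_category K "opposite A" by (fact k_linear_category_opposite)
  show ?thesis
    using automorphism_iff_if_minimal_right_almost_split[of Y Z f g u v]
      Op.automorphism_iff_if_minimal_right_almost_split[of Z Y g f v u] assms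
    by (simp add: automorphism_opposite minimal_right_almost_split_opposite)
qed

end
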